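(* Let $n\geq 1$. There is a constant $C$ depending only on $n$, and one may take $C=(2\pi e)^{\frac{n}{2}}$, such that the following holds for every probability density function $f$ on $\mathbb{R}^n$. (i) For $1<q<\infty$, if $f$ has finite covariance matrix $\Sigma$, then $$\exp_q(S_q(X))\leq C(\det\Sigma)^{\frac{1}{2}}.$$ (ii) For $0<q<1$, if $\|f\|_q<\infty$ and $f$ has finite $q$-covariance matrix $\Sigma_q$, then $$\exp_q(S_q(X))\leq C(\det\Sigma_q)^{\frac{1}{2}}.$$
   Context: All integrals are with respect to Lebesgue measure. For $0<q<\infty$, $\|f\|_q=\left(\int_{\mathbb{R}^n}|f(x)|^q\,d^nx\right)^{1/q}$. The Tsallis entropy of order $q\neq1$ of a random vector $X$ with density $f$ is $S_q(X)=\frac{1}{q-1}\left(1-\|f\|_q^q\right)$, and $\exp_q(x)=[1+(1-q)x]^{\frac{1}{1-q}}$. (If $q>1$ and $\|f\|_q=\infty$, then $S_q(X)=-\infty$ and $\exp_q(S_q(X))$ is read as $0$.) For $q>0$ with $0<\|f\|_q<\infty$, the $q$-expectation is $$E_q[X]=\frac{\int_{\mathbb{R}^n}x|f(x)|^q\,d^nx}{\int_{\mathbb{R}^n}|f(x)|^q\,d^nx},$$ with the analogous formula for functions of $X$ (replace $x$ in the numerator by that function of $x$), and the $q$-covariance matrix is $\Sigma_q=E_q\left[(X-E_q[X])(X-E_q[X])^T\right]$. It is called finite when $\int_{\mathbb{R}^n}|x|^2|f(x)|^q\,d^nx<\infty$. $\Sigma=\Sigma_1$ (the case of index $1$) is the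 usual covariance matrix. *)

theory Defs
  imports "HOL-Analysis.Analysis"
begin

definition prob_density :: "(real ^ 'n \<Rightarrow> real) \<Rightarrow> bool" where
  "prob_density f \<longleftrightarrow>
     f \<in> borel_measurable lebesgue \<and> (\<forall>x. 0 \<le> f x) \<and> (\<integral>\<^sup>+ x. ennreal (f x) \<partial>lebesgue) = 1"

text \<open>Powers of extended nonnegative reals; used for exponents \<open>r > 0\<close> only.\<close>

definition ennpowr :: "ennreal \<Rightarrow> real \<Rightarrow> ennreal" where
  "ennpowr a r = (if a = \<infinity> then \<infinity> else ennreal (enn2real a powr r))"

definition Lq_norm :: "real \<Rightarrow> (real ^ 'n \<Rightarrow> real) \<Rightarrow> ennreal" where
  "Lq_norm q f = ennpowr (\<integral>\<^sup>+ x. ennreal (\<bar>f x\<bar> powr q) \<partial>lebesgue) (1 / q)"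

text \<open>If the norm is infinite, arithmetic in \<^typ>\<open>ereal\<close> gives the value \<open>-\<infinity>\<close>
  for \<open>q > 1\<close> and \<open>\<infinity>\<close> for \<open>q < 1\<close>.\<close>

definition tsallis_entropy :: "real \<Rightarrow> (real ^ 'n \<Rightarrow> real) \<Rightarrow> ereal" where
  "tsallis_entropy q f = ereal (1 / (q - 1)) * (1 - enn2ereal (ennpowr (Lq_norm q f) q))"

text \<open>The two infinite arguments are the values of \<^const>\<open>tsallis_entropy\<close> at densities of infinite
  norm: \<open>-\<infinity>\<close> arises only for \<open>q > 1\<close>, and \<open>\<infinity>\<close> only for \<open>q < 1\<close>.\<close>

definition q_exp :: "real \<Rightarrow> ereal \<Rightarrow> ereal" where
  "q_exp q s = (case s of
       ereal x \<Rightarrow> ereal ((1 + (1 - q) * x) powr (1 / (1 - q)))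
     | PInfty \<Rightarrow> \<infinity>
     | MInfty \<Rightarrow> 0)"

text \<open>\<open>q_expectation q f g\<close> is the \<open>q\<close>-expectation of \<open>g(X)\<close>, where \<open>X\<close> has density \<open>f\<close>.\<close>

definition q_expectation ::
    "real \<Rightarrow> (real ^ 'n \<Rightarrow> real) \<Rightarrow> (real ^ 'n \<Rightarrow> 'b::euclidean_space) \<Rightarrow> 'b" where
  "q_expectation q f g =
     (LINT x|lebesgue. (\<bar>f x\<bar> powr q) *\<^sub>R g x) /\<^sub>R (LINT x|lebesgue. \<bar>f x\<bar> powr q)"

definition q_mean :: "real \<Rightarrow> (real ^ 'n \<Rightarrow> real) \<Rightarrow> real ^ 'n" where
  "q_mean q f = q_expectation q f (\<lambda>x. x)"

definition q_covariance :: "real \<Rightarrow> (real ^ 'n \<Rightarrow> real) \<Rightarrow> real ^ 'n ^ 'n" where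
  "q_covariance q f =
     q_expectation q f (\<lambda>x. \<chi> i j. (x - q_mean q f) $ i * (x - q_mean q f) $ j)"

definition finite_q_covariance :: "real \<Rightarrow> (real ^ 'n \<Rightarrow> real) \<Rightarrow> bool" where
  "finite_q_covariance q f \<longleftrightarrow>
     (\<integral>\<^sup>+ x. ennreal ((norm x)\<^sup>2 * \<bar>f x\<bar> powr q) \<partial>lebesgue) < \<infinity>"

end

theory Submission
  imports Defs "HOL-Probability.Distributions"
begin

text \<open>
  Writing out the definitions, \<open>exp\<^sub>q (S\<^sub>q X) = (\<integral> f\<^sup>q)\<^bsup>1/(1-q)\<^esup>\<close>, the exponential of a Renyi entropy.

  For \<open>q > 1\<close>, Renyi entropy is at most Shannon entropy, which is maximised by the Gaussian \<open>g\<close> with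
  the covariance matrix of \<open>f\<close>. Both steps are merged into one pointwise inequality, so that
  \<open>f log f\<close> never has to be integrated: with \<open>a = 1 / (C (det \<Sigma>)\<^bsup>1/2\<^esup>)\<close> and \<open>w = log (g / a)\<close>,
  \<open>f\<^sup>q \<ge> a\<^bsup>q-1\<^esup> (f + (q - 1) (f w + f - g))\<close>.
  The right-hand side integrates to \<open>a\<^bsup>q-1\<^esup>\<close> because \<open>\<integral> f w = 0\<close>. Instead of inverting \<open>\<Sigma>\<close>, the
  Gaussian is written with a matrix \<open>A\<close> such that \<open>A \<Sigma> A\<^sup>T = 1\<close>.

  For \<open>q < 1\<close>, the case of exponent \<open>1/q > 1\<close> is applied to the escort density \<open>h = f\<^sup>q / \<integral> f\<^sup>q\<close>, whose
  covariance matrix is \<open>\<Sigma>\<^sub>q\<close>; here \<open>\<integral> h\<^bsup>1/q\<^esup> = (\<integral> f\<^sup>q)\<^bsup>-1/q\<^esup>\<close> since \<open>\<integral> f = 1\<close>.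
\<close>

section \<open>Linear change of variables\<close>

text \<open>By Fubini the coordinate along \<open>b\<close> can be integrated first. On each line
  parallel to \<open>b\<close> the function \<open>g\<close> is constant, so the shear acts there as
  a translation, which preserves one-dimensional Lebesgue measure.\<close>

lemma nn_integral_lborel_shear:
  fixes b :: "'a::euclidean_space" and h :: "'a \<Rightarrow> ennreal"
  assumes b: "b \<in> Basis"
    and g[measurable]: "g \<in> borel_measurable borel"
    and inv: "\<And>x t. g (x + t *\<^sub>R b) = g x"
    and h[measurable]: "h \<in> borel_measurable borel"
  shows "(\<integral>\<^sup>+x. h (x + g x *\<^sub>R b) \<partial>lborel) = (\<integral>\<^sup>+x. h x \<partial>lborel)"
proof -
  define J where "J = (Basis :: 'a set) - {b}"
  have J: "finite J" "b \<notin> J" "(Basis :: 'a set) = insert b J"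
    using b by (auto simp: J_def)
  define S where "S z = (\<Sum>c\<in>J. z c *\<^sub>R c)" for z :: "'a \<Rightarrow> real"
  interpret product_sigma_finite "\<lambda>_::'a. lborel :: real measure" ..
  have split: "(\<integral>\<^sup>+x. k x \<partial>lborel) = (\<integral>\<^sup>+z. (\<integral>\<^sup>+t. k (S z + t *\<^sub>R b) \<partial>lborel) \<partial>PiM J (\<lambda>_. lborel))"
    if [measurable]: "k \<in> borel_measurable borel" for k :: "'a \<Rightarrow> ennreal"
  proof -
    have "(\<integral>\<^sup>+x. k x \<partial>lborel) =
        (\<integral>\<^sup>+y. k (\<Sum>c\<in>insert b J. y c *\<^sub>R c) \<partial>PiM (insert b J) (\<lambda>_. lborel))"
      by (subst lborel_eq, subst nn_integral_distr) (auto simp flip: J(3))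
    also have "\<dots> = (\<integral>\<^sup>+z. (\<integral>\<^sup>+t. k (\<Sum>c\<in>insert b J. (z(b := t)) c *\<^sub>R c) \<partial>lborel) \<partial>PiM J (\<lambda>_. lborel))"
      by (rule product_nn_integral_insert[OF J(1,2)]) measurable
    also have "\<dots> = (\<integral>\<^sup>+z. (\<integral>\<^sup>+t. k (S z + t *\<^sub>R b) \<partial>lborel) \<partial>PiM J (\<lambda>_. lborel))"
    proof (intro nn_integral_cong arg_cong[of _ _ k])
      fix z :: "'a \<Rightarrow> real" and t :: real
      have "(\<Sum>c\<in>J. (z(b := t)) c *\<^sub>R c) = S z"
        unfolding S_def using J(2) by (intro sum.cong) auto
      then show "(\<Sum>c\<in>insert b J. (z(b := t)) c *\<^sub>R c) = S z + t *\<^sub>R b"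
        using J(1,2) by (simp add: add.commute)
    qed
    finally show ?thesis .
  qed
  have "(\<integral>\<^sup>+t. h (S z + t *\<^sub>R b + g (S z + t *\<^sub>R b) *\<^sub>R b) \<partial>lborel) = (\<integral>\<^sup>+t. h (S z + t *\<^sub>R b) \<partial>lborel)" for z
    using nn_integral_real_affine[of "\<lambda>t. h (S z + t *\<^sub>R b)" 1 "g (S z)"]
    by (simp add: inv algebra_simps)
  then show ?thesis
    by (simp add: split)
qed

text \<open>Lebesgue measure is determined by its values on boxes. The preimage of a box is the box
  with permuted sides, and its volume is the same product in another order.\<close>

lemma lborel_distr_permute:
  fixes p :: "'n::finite \<Rightarrow> 'n"
  assumes p: "bij p"
  shows "distr lborel borel (\<lambda>x::real^'n. \<chi> i. x $ p i) = lborel"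
proof (rule sym, rule lborel_eqI)
  fix l u :: "real^'n"
  assume le: "\<And>b. b \<in> Basis \<Longrightarrow> l \<bullet> b \<le> u \<bullet> b"
  have [measurable]: "(\<lambda>x::real^'n. \<chi> i. x $ p i) \<in> borel_measurable borel"
    by (intro borel_measurable_continuous_onI continuous_intros)
  have surj: "p (inv p i) = i" for i using p by (simp add: bij_is_surj surj_f_inv_f)
  have eq: "(\<lambda>x::real^'n. \<chi> i. x $ p i) -` box l u = box (\<chi> i. l $ inv p i) (\<chi> i. u $ inv p i)"
    using surj p by (auto simp: mem_box_cart) (metis bij_inv_eq_iff)+
  have lei: "l $ i \<le> u $ i" for i
    using le[of "axis i 1"] by (auto simp: Basis_vec_def inner_axis)
  have B: "(Basis :: (real^'n) set) = range (\<lambda>i. axis i 1)" by (auto simp: Basis_vec_def)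
  have inj: "inj (\<lambda>i::'n. axis i (1::real))" by (simp add: inj_on_def axis_eq_axis)
  have prodB: "(\<Prod>b\<in>(Basis :: (real^'n) set). F b) = (\<Prod>i\<in>UNIV. F (axis i 1))" for F :: "_ \<Rightarrow> real"
    unfolding B by (subst prod.reindex[OF inj]) simp
  have le_B: "(\<forall>b\<in>(Basis :: (real^'n) set). P b) \<longleftrightarrow> (\<forall>i. P (axis i 1))" for P
    unfolding B by blast
  have "(\<Prod>i\<in>UNIV. u $ inv p i - l $ inv p i) = (\<Prod>i\<in>UNIV. u $ i - l $ i)"
    using prod.reindex_bij_betw[of "inv p" UNIV UNIV "\<lambda>i. u $ i - l $ i"] p by (simp add: bij_imp_bij_inv)
  then show "emeasure (distr lborel borel (\<lambda>x::real^'n. \<chi> i. x $ p i)) (box l u) = (\<Prod>b\<in>Basis. (u - l) \<bullet> b)"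
    using lei by (subst emeasure_distr)
      (auto simp: eq emeasure_lborel_box_eq prodB inner_axis le_B)
qed simp

lemma borel_measurable_matrix_vector_mult[measurable]:
  "(\<lambda>x. (A :: real^'n^'m) *v x) \<in> borel_measurable borel"
  by (intro borel_measurable_continuous_onI matrix_vector_mult_linear_continuous_on)

text \<open>The change of variables theorems of \<^theory>\<open>HOL-Analysis.Change_Of_Vars\<close> need a well-ordered
  index type, hence this version for arbitrary finite index types.\<close>

lemma nn_integral_lborel_matrix:
  fixes A :: "real^'n^'n" and h :: "real^'n \<Rightarrow> ennreal"
  assumes "det A \<noteq> 0" "h \<in> borel_measurable borel"
  shows "(\<integral>\<^sup>+x. h x \<partial>lborel) = ennreal \<bar>det A\<bar> * (\<integral>\<^sup>+x. h (A *v x) \<partial>lborel)"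
  using assms
\<comment> \<open>Induction over products of elementary matrices: products compose, a zero row
  contradicts \<open>det A \<noteq> 0\<close>, diagonal matrices scale the axes, transpositions
  permute them, and adding one coordinate to another is a shear.\<close>
proof (induction A arbitrary: h rule: induct_matrix_elementary_alt)
  case (1 A B)
  note [measurable] = 1(4)
  have "(\<lambda>x. h (A *v x)) \<in> borel_measurable borel"
    by measurable
  moreover have "det A \<noteq> 0" "det B \<noteq> 0"
    using 1(3) by (auto simp: det_mul)
  ultimately show ?case
    using 1(1)[of h] 1(2)[of "\<lambda>x. h (A *v x)"] 1(4)
    by (simp add: det_mul abs_mult ennreal_mult' mult.assoc matrix_vector_mul_assoc)
next
  case (2 A i)
  then show ?case by (simp add: det_zero_row)
next
  case (3 A)
  note [measurable] = 3(3)
  have det: "det A = (\<Prod>i\<in>UNIV. A $ i $ i)"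
    using 3(1) by (rule det_diagonal)
  have B: "(Basis :: (real^'n) set) = range (\<lambda>i. axis i 1)" by (auto simp: Basis_vec_def)
  have inj: "inj (\<lambda>i::'n. axis i (1::real))" by (simp add: inj_on_def axis_eq_axis)
  \<comment> \<open>\<open>lborel_affine_euclidean\<close> takes scaling factors indexed by basis
    vectors; this quadratic form returns the \<open>i\<close>-th diagonal entry at
    \<open>axis i 1\<close>.\<close>
  define c where "c v = v \<bullet> (A *v v)" for v
  have c: "c (axis i 1) = A $ i $ i" for i
    by (simp add: c_def inner_axis inner_axis' matrix_vector_mul_component)
  have nz: "A $ i $ i \<noteq> 0" for i
    using 3(2) unfolding det by simp
  have "(\<Sum>j\<in>Basis. (c j * (x \<bullet> j)) *\<^sub>R j) = (\<Sum>i\<in>UNIV. (A $ i $ i * x $ i) *\<^sub>R axis i 1)" for x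
    unfolding B by (subst sum.reindex[OF inj]) (simp add: c inner_axis)
  also have "(\<Sum>i\<in>UNIV. (A $ i $ i * x $ i) *\<^sub>R axis i 1) = A *v x" for x
  proof -
    have "(\<Sum>j\<in>UNIV. A $ i $ j * x $ j) = A $ i $ i * x $ i" for i
      using 3(1) by (subst sum.remove[of _ i]) (auto intro!: sum.neutral)
    then show ?thesis
      by (simp add: vec_eq_iff matrix_vector_mult_def axis_def if_distrib cong: if_cong)
  qed
  finally have T: "(\<Sum>j\<in>Basis. (c j * (x \<bullet> j)) *\<^sub>R j) = A *v x" for x .
  have "(\<Prod>j\<in>Basis. \<bar>c j\<bar>) = \<bar>det A\<bar>"
    unfolding B det by (subst prod.reindex[OF inj]) (simp add: c abs_prod)
  moreover have "c j \<noteq> 0" if "j \<in> Basis" for j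
    using that nz by (auto simp: B c)
  ultimately have "lborel = density (distr lborel borel (\<lambda>x. A *v x)) (\<lambda>_. ennreal \<bar>det A\<bar>)"
    using lborel_affine_euclidean[of c 0] by (simp add: T)
  then have "(\<integral>\<^sup>+x. h x \<partial>lborel) =
      (\<integral>\<^sup>+x. h x \<partial>density (distr lborel borel (\<lambda>x. A *v x)) (\<lambda>_. ennreal \<bar>det A\<bar>))"
    by simp
  then show ?case
    by (simp add: nn_integral_density nn_integral_distr nn_integral_cmult)
next
  case (4 m n)
  note [measurable] = 4(3)
  let ?p = "Transposition.transpose m n"
  have mv: "(\<chi> i j. (mat 1 :: real^'n^'n) $ i $ ?p j) *v x = (\<chi> i. x $ ?p i)" for x
  proof -
    have "(\<Sum>j\<in>UNIV. (if i = ?p j then 1 else 0) * x $ j) = x $ ?p i" for i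
    proof -
      have "(i = ?p j) = (j = ?p i)" for j
        by (metis transpose_involutory)
      then show ?thesis
        by (simp add: if_distrib[of "\<lambda>t. t * _"] cong: if_cong)
    qed
    then show ?thesis
      by (simp add: vec_eq_iff matrix_vector_mult_def mat_def)
  qed
  have "\<bar>det (\<chi> i j. (mat 1 :: real^'n^'n) $ i $ ?p j)\<bar> = 1"
    using det_permute_columns[of ?p "mat 1 :: real^'n^'n"]
    by (simp add: permutes_swap_id sign_swap_id)
  moreover have "(\<integral>\<^sup>+x. h x \<partial>lborel) = (\<integral>\<^sup>+x. h x \<partial>distr lborel borel (\<lambda>x. \<chi> i. x $ ?p i))"
    by (simp add: lborel_distr_permute)
  moreover have "(\<lambda>x::real^'n. \<chi> i. x $ ?p i) \<in> borel_measurable borel"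
    by (intro borel_measurable_continuous_onI continuous_intros)
  ultimately show ?case
    by (simp add: mv nn_integral_distr)
next
  case (5 m n)
  let ?E = "(\<chi> i j. of_bool (i = m \<and> j = n \<or> i = j)) :: real^'n^'n"
  have "?E = (\<chi> k. if k = m then row m (mat 1) + 1 *s row n (mat 1) else row k (mat 1))"
    using 5 by (auto simp: vec_eq_iff row_def mat_def)
  then have det: "det ?E = 1"
    using det_row_operation[OF 5(1), of "mat 1 :: real^'n^'n" 1] by simp
  have mv: "?E *v x = x + x $ n *\<^sub>R axis m 1" for x
  proof -
    have "(\<Sum>j\<in>UNIV. of_bool (i = m \<and> j = n \<or> i = j) * x $ j) = x $ i + x $ n * (if i = m then 1 else 0)" for i
    proof -
      have "of_bool (i = m \<and> j = n \<or> i = j) * x $ j =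
          (if j = i then x $ j else 0) + (if j = n then (if i = m then x $ j else 0) else 0)" for j
        using 5(1) by auto
      then show ?thesis
        by (simp add: sum.distrib)
    qed
    then show ?thesis
      by (simp add: vec_eq_iff matrix_vector_mult_def axis_def)
  qed
  \<comment> \<open>Since \<open>m \<noteq> n\<close>, the coordinate \<open>x $ n\<close> does not
    change along \<open>axis m 1\<close>, so the map is a shear.\<close>
  have "(\<lambda>x::real^'n. x $ n) \<in> borel_measurable borel"
    by (intro borel_measurable_continuous_onI continuous_intros)
  then have "(\<integral>\<^sup>+x. h (x + x $ n *\<^sub>R axis m 1) \<partial>lborel) = (\<integral>\<^sup>+x. h x \<partial>lborel)"
    using 5 by (intro nn_integral_lborel_shear) (auto simp: Basis_vec_def axis_def)
  then show ?case
    by (simp only: det mv) simp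
qed

section \<open>Gaussian integrals\<close>

text \<open>The integrand is a product over the coordinates, and each one-dimensional factor
  integrates to \<open>sqrt (2 * pi)\<close> because the standard normal density has mass 1.\<close>

lemma nn_integral_exp_neg_norm_sq:
  "(\<integral>\<^sup>+x. ennreal (exp (- (norm (x::real^'n))\<^sup>2 / 2)) \<partial>lborel) = ennreal ((2 * pi) powr (real CARD('n) / 2))"
proof -
  have one: "(\<integral>\<^sup>+t. ennreal (exp (- (t\<^sup>2 / 2))) \<partial>lborel) = ennreal (sqrt (2 * pi))"
  proof -
    have "(\<integral>\<^sup>+t. ennreal (std_normal_density t) \<partial>lborel) = 1"
      using integrable_normal_density[of 1 0] integral_normal_density[of 1 0]
      by (subst nn_integral_eq_integral) auto
    then have "ennreal (sqrt (2 * pi)) * (\<integral>\<^sup>+t. ennreal (std_normal_density t) \<partial>lborel) = ennreal (sqrt (2 * pi))"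
      by simp
    then show ?thesis
      by (simp add: std_normal_density_def nn_integral_cmult[symmetric] flip: ennreal_mult)
  qed
  have 1: "exp (- (norm x)\<^sup>2 / 2) = (\<Prod>b\<in>Basis. exp (- (x \<bullet> b)\<^sup>2 / 2))" for x :: "real^'n"
    proof -
    have "(norm x)\<^sup>2 = (\<Sum>b\<in>Basis. (x \<bullet> b)\<^sup>2)"
      by (subst power2_norm_eq_inner, subst euclidean_inner) (simp add: power2_eq_square)
    then show ?thesis
      by (simp add: exp_sum[symmetric] sum_divide_distrib sum_negf)
  qed
  have "(\<integral>\<^sup>+x. ennreal (exp (- (norm (x::real^'n))\<^sup>2 / 2)) \<partial>lborel) =
      (\<integral>\<^sup>+x. (\<Prod>b\<in>Basis. ennreal (exp (- ((x::real^'n) \<bullet> b)\<^sup>2 / 2))) \<partial>lborel)"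
    by (simp only: 1) (simp add: prod_ennreal)
  also have "\<dots> = ennreal (sqrt (2 * pi)) ^ CARD('n)"
    by (subst nn_integral_lborel_prod) (simp_all add: one)
  also have "\<dots> = ennreal ((2 * pi) powr (real CARD('n) / 2))"
    by (simp add: ennreal_power powr_half_sqrt[symmetric] powr_power)
  finally show ?thesis .
qed

text \<open>Substitute \<open>y = A *v (x - m)\<close>: the translation preserves the measure and
  the linear part contributes the factor \<open>\<bar>det A\<bar>\<close>.\<close>

lemma nn_integral_gaussian_affine:
  fixes A :: "real^'n^'n"
  assumes A: "det A \<noteq> 0"
  shows "ennreal \<bar>det A\<bar> * (\<integral>\<^sup>+x. ennreal (exp (- (norm (A *v (x - m)))\<^sup>2 / 2)) \<partial>lborel)
    = ennreal ((2 * pi) powr (real CARD('n) / 2))"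
proof -
  let ?h = "\<lambda>y::real^'n. ennreal (exp (- (norm y)\<^sup>2 / 2))"
  have "(\<integral>\<^sup>+x. ?h (A *v (x - m)) \<partial>lborel) = (\<integral>\<^sup>+x. ?h (A *v x) \<partial>distr lborel borel ((+) (- m)))"
    by (subst nn_integral_distr) simp_all
  also have "\<dots> = (\<integral>\<^sup>+x. ?h (A *v x) \<partial>lborel)"
    by (simp add: lborel_distr_plus)
  finally show ?thesis
    using nn_integral_lborel_matrix[OF A, of ?h] nn_integral_exp_neg_norm_sq[where 'n='n] by simp
qed

section \<open>Covariance matrices\<close>

text \<open>Lets the equation \<open>A ** S ** transpose A = mat 1\<close> be read as orthonormality
  of the rows of \<open>A\<close> for the bilinear form of \<open>S\<close>.\<close>

lemma matrix_conjugate_nth: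
  fixes A S :: "real^'n^'n"
  shows "(A ** S ** transpose A) $ i $ j = A $ i \<bullet> (S *v A $ j)"
proof -
  have "transpose A *v axis j 1 = A $ j"
    by (simp add: matrix_vector_mult_basis column_def transpose_def)
  then have "((A ** S ** transpose A) *v axis j 1) $ i = A $ i \<bullet> (S *v A $ j)"
    by (simp add: matrix_vector_mul_component flip: matrix_vector_mul_assoc)
  then show ?thesis
    by (simp add: matrix_vector_mult_basis column_def)
qed

text \<open>A Gram-Schmidt argument for the inner product \<open>u \<bullet> (S *v v)\<close>: an
  orthonormal family is extended one index at a time, and its members become the rows of
  \<open>A\<close>.\<close>

lemma exists_whitening_matrix:
  fixes S :: "real^'n^'n"
  assumes sym: "transpose S = S" and pos: "\<And>v. v \<noteq> 0 \<Longrightarrow> 0 < v \<bullet> (S *v v)"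
  shows "\<exists>A::real^'n^'n. A ** S ** transpose A = mat 1"
proof -
  have S_sym: "u \<bullet> (S *v v) = v \<bullet> (S *v u)" for u v
    by (metis sym dot_lmul_matrix inner_commute transpose_matrix_vector)
  have "\<exists>b. \<forall>i\<in>I. \<forall>j\<in>I. b i \<bullet> (S *v b j) = (if i = j then 1 else 0)" if "finite I" for I :: "'n set"
    using that
  proof induction
    case (insert k I)
    then obtain b where b: "\<forall>i\<in>I. \<forall>j\<in>I. b i \<bullet> (S *v b j) = (if i = j then 1 else 0)"
      by blast
    \<comment> \<open>These vectors number fewer than \<open>CARD('n)\<close>, so some nonzero
      \<open>v\<close> is orthogonal to all of them in the usual sense, hence orthogonal to every
      \<open>b i\<close> in the sense of \<open>S\<close>.\<close>
    let ?W = "(\<lambda>i. S *v b i) ` I"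
    have "dim (span ?W) \<le> card I"
      using dim_le_card'[of ?W] card_image_le[of I "\<lambda>i. S *v b i"] insert.hyps(1)
      by simp
    also have "card I < CARD('n)"
      using insert.hyps by (intro psubset_card_mono) auto
    finally obtain v where v: "v \<noteq> 0" "\<And>y. y \<in> span ?W \<Longrightarrow> orthogonal v y"
      using orthogonal_to_subspace_exists[of ?W] by auto
    have orth: "v \<bullet> (S *v b i) = 0" if "i \<in> I" for i
      using v(2)[OF span_base, of "S *v b i"] that by (auto simp: orthogonal_def)
    define r where "r = v \<bullet> (S *v v)"
    have r: "r > 0" using pos[OF v(1)] by (simp add: r_def)
    define b' where "b' = b(k := v /\<^sub>R sqrt r)"
    have "b' i \<bullet> (S *v b' j) = (if i = j then 1 else 0)" if ij: "i \<in> insert k I" "j \<in> insert k I" for i j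
    proof -
      consider "i = k" "j = k" | "i = k" "j \<in> I" "j \<noteq> k" | "j = k" "i \<in> I" "i \<noteq> k"
        | "i \<in> I" "j \<in> I" "i \<noteq> k" "j \<noteq> k"
        using ij insert.hyps(2) by blast
      then show ?thesis
      proof cases
        case 1
        have "inverse (sqrt r) * (inverse (sqrt r) * r) = 1"
          using r by (simp add: field_simps)
        with 1 show ?thesis
          by (simp add: b'_def matrix_vector_mult_scaleR flip: r_def)
      next
        case 3
        then show ?thesis
          using orth[of i] S_sym[of "b i" v] by (simp add: b'_def matrix_vector_mult_scaleR)
      qed (use b orth in \<open>auto simp: b'_def\<close>)
    qed
    then show ?case by blast
  qed simp
  from this[of UNIV] obtain b :: "'n \<Rightarrow> real^'n" where
    b: "\<And>i j. b i \<bullet> (S *v b j) = (if i = j then 1 else 0)"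
    by auto
  have "(\<chi> i. b i) ** S ** transpose (\<chi> i. b i) = mat 1"
    by (simp add: vec_eq_iff matrix_conjugate_nth b mat_def)
  then show ?thesis by blast
qed

section \<open>Second moments of densities\<close>

text \<open>The rank-one matrix \<open>a a^T\<close>; the covariance matrix is a Bochner integral of
  such matrices.\<close>

definition outer_sq :: "real^'n \<Rightarrow> real^'n^'n" where
  "outer_sq a = (\<chi> i j. a $ i * a $ j)"

lemma outer_sq_mult_vec: "outer_sq a *v v = (a \<bullet> v) *\<^sub>R a"
  by (simp add: outer_sq_def vec_eq_iff matrix_vector_mult_def inner_vec_def sum_distrib_left mult_ac)

text \<open>The norm of nested vectors is the Frobenius norm, which factors on a rank-one matrix.
  This turns matrix integrability into a scalar second-moment bound.\<close>

lemma norm_outer_sq: "norm (outer_sq a) = (norm a)\<^sup>2"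
proof -
  have "outer_sq a $ i = a $ i *\<^sub>R a" for i
    by (simp add: outer_sq_def vec_eq_iff)
  then have "norm (outer_sq a) = L2_set (\<lambda>i. norm (a $ i) * norm a) UNIV"
    unfolding norm_vec_def[of "outer_sq a"] by simp
  also have "\<dots> = L2_set (\<lambda>i. norm (a $ i)) UNIV * norm a"
    by (simp add: L2_set_left_distrib)
  finally show ?thesis
    by (simp add: norm_vec_def[of a] power2_eq_square)
qed

lemma lborel_to_lebesgue_measurable:
  "f \<in> borel_measurable borel \<Longrightarrow> f \<in> borel_measurable lebesgue"
  by (simp add: measurable_completion)

lemma prob_density_integral:
  fixes f :: "real^'n \<Rightarrow> real"
  assumes "prob_density f"
  shows "integrable lebesgue f" "(LINT x|lebesgue. f x) = 1"
proof -
  have f: "f \<in> borel_measurable lebesgue" "\<And>x. 0 \<le> f x" "(\<integral>\<^sup>+ x. ennreal (f x) \<partial>lebesgue) = 1"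
    using assms by (auto simp: prob_density_def)
  show i: "integrable lebesgue f"
    using f by (intro integrableI_nonneg) auto
  show "(LINT x|lebesgue. f x) = 1"
    using f nn_integral_eq_integral[OF i] by simp
qed

text \<open>By \<open>(s + t)^2 \<le> 2 s^2 + 2 t^2\<close>, the second moment about any centre
  \<open>m\<close> is dominated by the one about the origin and the total mass.\<close>

lemma integrable_outer_sq:
  fixes f :: "real^'n \<Rightarrow> real"
  assumes f: "prob_density f" and cov: "finite_q_covariance 1 f"
  shows "integrable lebesgue (\<lambda>x. f x *\<^sub>R outer_sq (x - m))"
proof -
  have f0: "f x \<ge> 0" and [measurable]: "f \<in> borel_measurable lebesgue" for x
    using f by (auto simp: prob_density_def)
  have [measurable]: "(\<lambda>x. (norm x)\<^sup>2) \<in> borel_measurable (lebesgue :: (real^'n) measure)"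
    by (intro lborel_to_lebesgue_measurable) measurable
  have "continuous_on UNIV (\<lambda>x. outer_sq (x - m))"
    unfolding outer_sq_def by (intro continuous_intros)
  then have [measurable]: "(\<lambda>x. outer_sq (x - m)) \<in> borel_measurable lebesgue"
    by (intro lborel_to_lebesgue_measurable borel_measurable_continuous_onI)
  have sq: "integrable lebesgue (\<lambda>x. f x * (norm x)\<^sup>2)"
    using cov f0 unfolding finite_q_covariance_def
    by (intro integrableI_nonneg) (auto simp: mult.commute)
  show ?thesis
  proof (rule Bochner_Integration.integrable_bound)
    show "integrable lebesgue (\<lambda>x. 2 * (f x * (norm x)\<^sup>2) + 2 * (norm m)\<^sup>2 * f x)"
      using sq prob_density_integral(1)[OF f] by simp
    have "(norm (x - m))\<^sup>2 \<le> 2 * (norm x)\<^sup>2 + 2 * (norm m)\<^sup>2" for x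
    proof -
      have "(norm (x - m))\<^sup>2 \<le> (norm x + norm m)\<^sup>2"
        by (intro power_mono norm_triangle_ineq4) auto
      also have "\<dots> \<le> 2 * (norm x)\<^sup>2 + 2 * (norm m)\<^sup>2"
        by (smt (verit) power2_diff power2_sum zero_le_power2)
      finally show ?thesis .
    qed
    then have "f x * (norm (x - m))\<^sup>2 \<le> f x * (2 * (norm x)\<^sup>2 + 2 * (norm m)\<^sup>2)" for x
      using f0 by (intro mult_left_mono) auto
    then show "AE x in lebesgue. norm (f x *\<^sub>R outer_sq (x - m))
        \<le> norm (2 * (f x * (norm x)\<^sup>2) + 2 * (norm m)\<^sup>2 * f x)"
      using f0 by (intro AE_I2) (simp add: norm_outer_sq algebra_simps)
  qed measurable
qed

text \<open>For fixed \<open>u\<close> and \<open>v\<close> the map from \<open>M\<close> to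
  \<open>u \<bullet> (M *v v)\<close> is bounded and linear, so it commutes with the matrix-valued
  integral.\<close>

lemma covariance_form:
  fixes f :: "real^'n \<Rightarrow> real"
  assumes f: "prob_density f" and cov: "finite_q_covariance 1 f"
  defines "m \<equiv> q_mean 1 f"
  shows "integrable lebesgue (\<lambda>x. f x * ((u \<bullet> (x - m)) * (v \<bullet> (x - m))))"
    and "u \<bullet> (q_covariance 1 f *v v) = (LINT x|lebesgue. f x * ((u \<bullet> (x - m)) * (v \<bullet> (x - m))))"
proof -
  have f0: "f x \<ge> 0" for x
    using f by (auto simp: prob_density_def)
  have "linear (\<lambda>M::real^'n^'n. u \<bullet> (M *v v))"
    by (rule linearI) (simp_all add: matrix_vector_mult_add_rdistrib inner_add_right scaleR_matrix_vector_assoc[symmetric])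
  then have bl: "bounded_linear (\<lambda>M::real^'n^'n. u \<bullet> (M *v v))"
    by (simp add: linear_conv_bounded_linear)
  have eq: "u \<bullet> ((f x *\<^sub>R outer_sq (x - m)) *v v) = f x * ((u \<bullet> (x - m)) * (v \<bullet> (x - m)))" for x
    by (simp add: scaleR_matrix_vector_assoc[symmetric] outer_sq_mult_vec inner_commute mult_ac)
  have I: "integrable lebesgue (\<lambda>x. f x *\<^sub>R outer_sq (x - m))"
    using f cov by (rule integrable_outer_sq)
  show "integrable lebesgue (\<lambda>x. f x * ((u \<bullet> (x - m)) * (v \<bullet> (x - m))))"
    using integrable_bounded_linear[OF bl I] by (simp add: eq)
  \<comment> \<open>The denominator of the expectation is the total mass 1.\<close>
  have "q_covariance 1 f = (LINT x|lebesgue. f x *\<^sub>R outer_sq (x - m))"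
    using f0 prob_density_integral(2)[OF f]
    by (simp add: q_covariance_def q_expectation_def outer_sq_def m_def)
  then show "u \<bullet> (q_covariance 1 f *v v) = (LINT x|lebesgue. f x * ((u \<bullet> (x - m)) * (v \<bullet> (x - m))))"
    using integral_bounded_linear[OF bl I] by (simp add: eq)
qed

text \<open>If the quadratic form vanished, \<open>f\<close> would vanish almost everywhere off the
  hyperplane \<open>v \<bullet> x = v \<bullet> m\<close>. That hyperplane is null, so
  \<open>f\<close> could not have mass 1.\<close>

lemma covariance_pos_def:
  fixes f :: "real^'n \<Rightarrow> real"
  assumes f: "prob_density f" and cov: "finite_q_covariance 1 f" and v: "v \<noteq> 0"
  shows "0 < v \<bullet> (q_covariance 1 f *v v)"
proof -
  define m where "m = q_mean 1 f"
  have f0: "f x \<ge> 0" for x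
    using f by (auto simp: prob_density_def)
  let ?k = "\<lambda>x. f x * ((v \<bullet> (x - m)) * (v \<bullet> (x - m)))"
  note form = covariance_form[OF f cov, of v v, folded m_def]
  have k0: "0 \<le> ?k x" for x
    using f0 by simp
  have "(LINT x|lebesgue. ?k x) \<noteq> 0"
  proof
    assume "(LINT x|lebesgue. ?k x) = 0"
    then have "AE x in lebesgue. ?k x = 0"
      using integral_nonneg_eq_0_iff_AE[OF form(1)] k0 by simp
    moreover have "AE x in lebesgue. v \<bullet> x \<noteq> v \<bullet> m"
      using negligible_hyperplane[of v "v \<bullet> m"] v
      by (auto simp: negligible_iff_null_sets dest: AE_not_in)
    ultimately have "AE x in lebesgue. ennreal (f x) = 0"
      by eventually_elim (auto simp: inner_diff_right)
    then have "(\<integral>\<^sup>+ x. ennreal (f x) \<partial>lebesgue) = 0"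
      by (subst nn_integral_cong_AE[of _ "\<lambda>_. 0"]) auto
    then show False
      using f by (simp add: prob_density_def)
  qed
  moreover have "(LINT x|lebesgue. ?k x) \<ge> 0"
    using k0 by simp
  ultimately show ?thesis
    using form(2) by simp
qed

lemma transpose_covariance:
  fixes f :: "real^'n \<Rightarrow> real"
  assumes f: "prob_density f" and cov: "finite_q_covariance 1 f"
  shows "transpose (q_covariance 1 f) = q_covariance 1 f"
proof -
  have "axis i 1 \<bullet> (q_covariance 1 f *v axis j 1) = axis j 1 \<bullet> (q_covariance 1 f *v axis i 1)" for i j
    by (simp add: covariance_form(2)[OF f cov] mult.commute mult.left_commute)
  then show ?thesis
    by (simp add: vec_eq_iff transpose_def inner_axis' matrix_vector_mult_basis column_def)
qed

text \<open>Taking determinants in the whitening equation gives the second claim;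
  \<open>\<bar>det A\<bar>\<close> thereby stands for the inverse square root of the determinant of
  the covariance matrix.\<close>

lemma exists_whitening_covariance:
  fixes f :: "real^'n \<Rightarrow> real"
  assumes f: "prob_density f" and cov: "finite_q_covariance 1 f"
  obtains A :: "real^'n^'n" where "A ** q_covariance 1 f ** transpose A = mat 1"
    "det (q_covariance 1 f) = 1 / (det A)\<^sup>2" "det A \<noteq> 0"
proof -
  obtain A :: "real^'n^'n" where A: "A ** q_covariance 1 f ** transpose A = mat 1"
    using exists_whitening_matrix[OF transpose_covariance[OF f cov] covariance_pos_def[OF f cov]] by blast
  have "det (A ** q_covariance 1 f ** transpose A) = 1"
    unfolding A by simp
  then have dd: "(det A)\<^sup>2 * det (q_covariance 1 f) = 1"
    by (simp add: det_mul power2_eq_square mult_ac)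
  then have dA: "det A \<noteq> 0" by auto
  then have "det (q_covariance 1 f) = 1 / (det A)\<^sup>2"
    using dd by (simp add: field_simps)
  with A dA that show thesis by blast
qed

lemma det_covariance_pos:
  fixes f :: "real^'n \<Rightarrow> real"
  assumes f: "prob_density f" and cov: "finite_q_covariance 1 f"
  shows "0 < det (q_covariance 1 f)"
proof -
  obtain A :: "real^'n^'n" where "det (q_covariance 1 f) = 1 / (det A)\<^sup>2" "det A \<noteq> 0"
    using exists_whitening_covariance[OF assms] .
  then show ?thesis by simp
qed

section \<open>Entropy bounds\<close>

text \<open>Here \<open>y\<close> is a value of the density and \<open>a * exp w\<close> the
  Gaussian at the same point. The first convexity bound is Gibbs' inequality before integration, the
  second compares the power with the logarithm.\<close>

lemma gibbs_tangent:
  fixes y a q w :: real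
  assumes "y \<ge> 0" "a > 0" "q > 1"
  shows "a powr (q - 1) * (y + (q - 1) * (y * w + y - a * exp w)) \<le> y powr q"
proof (cases "y = 0")
  case True
  with assms show ?thesis
    by (simp add: mult_nonneg_nonpos zero_le_mult_iff)
next
  case False
  \<comment> \<open>Two tangent lines: \<open>exp t \<ge> 1 + t\<close> at \<open>t = w - l\<close> and at \<open>t = (q - 1) l\<close>.\<close>
  define l where "l = ln (y / a)"
  have y: "y > 0" "y = a * exp l"
    using assms False by (auto simp: l_def)
  have "y * (1 + (w - l)) \<le> y * exp (w - l)"
    using y(1) by (intro mult_left_mono exp_ge_add_one_self) auto
  also have "y * exp (w - l) = a * exp w"
    using y(2) by (simp add: exp_diff)
  finally have 1: "y * w + y - a * exp w \<le> y * l"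
    by (simp add: algebra_simps)
  have "y + (q - 1) * (y * w + y - a * exp w) \<le> y + (q - 1) * (y * l)"
    using 1 assms by (intro add_left_mono mult_left_mono) auto
  also have "\<dots> = y * (1 + (q - 1) * l)"
    by (simp add: algebra_simps)
  also have "\<dots> \<le> y * exp ((q - 1) * l)"
    using y(1) by (intro mult_left_mono exp_ge_add_one_self) auto
  finally have "a powr (q - 1) * (y + (q - 1) * (y * w + y - a * exp w)) \<le> a powr (q - 1) * (y * exp ((q - 1) * l))"
    by (intro mult_left_mono) auto
  also have "\<dots> = y * (a * exp l) powr (q - 1)"
    using assms by (simp add: powr_mult powr_def[of "exp l"])
  also have "\<dots> = y powr q"
    using y(1) powr_mult_base[of y "q - 1"] by (simp flip: y(2))
  finally show ?thesis .
qed

lemma gaussian_power_bound: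
  fixes f :: "real^'n \<Rightarrow> real"
  assumes f: "prob_density f" and q: "q > 1" and int_fq: "integrable lebesgue (\<lambda>x. f x powr q)"
    and A: "det A \<noteq> 0"
    and int_sq: "integrable lebesgue (\<lambda>x. f x * (norm (A *v (x - m)))\<^sup>2)"
    and second_moment: "(LINT x|lebesgue. f x * (norm (A *v (x - m)))\<^sup>2) = real CARD('n)"
  shows "(\<bar>det A\<bar> / (2 * pi * exp 1) powr (real CARD('n) / 2)) powr (q - 1) \<le> (LINT x|lebesgue. f x powr q)"
proof -
  define n where "n = real CARD('n)"
  define a where "a = \<bar>det A\<bar> / (2 * pi * exp 1) powr (n / 2)"
  \<comment> \<open>The factor \<open>exp (n / 2)\<close> in the denominator of \<open>a\<close>
    reappears as the summand \<open>n / 2\<close>. It cancels half the second moment, so that the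
    integral of \<open>f x * w x\<close> is 0.\<close>
  define w where "w x = n / 2 - (norm (A *v (x - m)))\<^sup>2 / 2" for x
  define g where "g x = a * exp (w x)" for x
  have a: "a > 0"
    using A by (simp add: a_def)
  have f0: "f x \<ge> 0" for x
    using f by (auto simp: prob_density_def)
  note int_f = prob_density_integral[OF f]
  have fw: "f x * w x = n / 2 * f x - f x * (norm (A *v (x - m)))\<^sup>2 / 2" for x
    by (simp add: w_def algebra_simps)
  have int_fw: "integrable lebesgue (\<lambda>x. f x * w x)"
    unfolding fw using int_f(1) int_sq by simp
  have fw_0: "(LINT x|lebesgue. f x * w x) = 0"
    unfolding fw using int_f int_sq second_moment by (simp add: n_def)
  have w_meas: "w \<in> borel_measurable borel"
    unfolding w_def by measurable
  then have g_meas: "g \<in> borel_measurable lebesgue"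
    unfolding g_def by (intro lborel_to_lebesgue_measurable) measurable
  have g0: "g x \<ge> 0" for x
    using a by (simp add: g_def)
  have e: "(2 * pi * exp 1) powr (n / 2) = (2 * pi) powr (n / 2) * exp (n / 2)"
    by (simp add: powr_mult powr_def[of "exp 1"])
  have w_eq: "exp (w x) = exp (n / 2) * exp (- (norm (A *v (x - m)))\<^sup>2 / 2)" for x
    by (simp add: w_def flip: exp_add)
  have g_eq: "g x = \<bar>det A\<bar> * exp (- (norm (A *v (x - m)))\<^sup>2 / 2) / (2 * pi) powr (n / 2)" for x
    unfolding g_def a_def w_eq e by simp
  have "(\<integral>\<^sup>+x. ennreal (g x) \<partial>lebesgue) = (\<integral>\<^sup>+x. ennreal (g x) \<partial>lborel)"
    by (rule nn_integral_completion)
  also have "\<dots> = (\<integral>\<^sup>+x. ennreal (1 / (2 * pi) powr (n / 2)) *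
      (ennreal \<bar>det A\<bar> * ennreal (exp (- (norm (A *v (x - m)))\<^sup>2 / 2))) \<partial>lborel)"
    by (intro nn_integral_cong) (simp add: g_eq flip: ennreal_mult)
  also have "\<dots> = ennreal (1 / (2 * pi) powr (n / 2)) *
      (ennreal \<bar>det A\<bar> * (\<integral>\<^sup>+x. ennreal (exp (- (norm (A *v (x - m)))\<^sup>2 / 2)) \<partial>lborel))"
    by (simp add: nn_integral_cmult)
  also have "\<dots> = 1"
    unfolding nn_integral_gaussian_affine[OF A] by (simp add: n_def flip: ennreal_mult)
  finally have nn_g: "(\<integral>\<^sup>+x. ennreal (g x) \<partial>lebesgue) = 1" .
  have int_g: "integrable lebesgue g"
    using g_meas g0 nn_g by (intro integrableI_nonneg) auto
  have g_1: "(LINT x|lebesgue. g x) = 1"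
    using nn_integral_eq_integral[OF int_g] g0 nn_g by simp
  \<comment> \<open>The numerals are the integrals of \<open>f\<close>, \<open>f w\<close>,
    \<open>f\<close> and \<open>g\<close>, in the order in which these occur in the tangent
    bound.\<close>
  have "a powr (q - 1) = a powr (q - 1) * (1 + (q - 1) * (0 + 1 - 1))"
    by simp
  also have "\<dots> = (LINT x|lebesgue. a powr (q - 1) * (f x + (q - 1) * (f x * w x + f x - g x)))"
    using int_f int_fw int_g by (simp add: fw_0 g_1)
  also have "\<dots> \<le> (LINT x|lebesgue. f x powr q)"
  proof (rule integral_mono)
    show "integrable lebesgue (\<lambda>x. a powr (q - 1) * (f x + (q - 1) * (f x * w x + f x - g x)))"
      using int_f(1) int_fw int_g by simp
    show "a powr (q - 1) * (f x + (q - 1) * (f x * w x + f x - g x)) \<le> f x powr q" for x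
      unfolding g_def using f0 a q by (rule gibbs_tangent)
  qed (rule int_fq)
  finally show ?thesis
    by (simp add: a_def n_def)
qed

text \<open>Whitening makes each row of \<open>A\<close> contribute 1 to the second moment, which is
  therefore \<open>CARD('n)\<close>, as the Gaussian bound demands. The result serves both the
  density itself and its escort density.\<close>

lemma covariance_power_bound:
  fixes f :: "real^'n \<Rightarrow> real"
  assumes f: "prob_density f" and cov: "finite_q_covariance 1 f" and q: "q > 1"
    and int_fq: "integrable lebesgue (\<lambda>x. f x powr q)"
  shows "(LINT x|lebesgue. f x powr q) powr (1 / (1 - q))
    \<le> (2 * pi * exp 1) powr (real CARD('n) / 2) * sqrt (det (q_covariance 1 f))"
proof -
  define S where "S = q_covariance 1 f"
  define m where "m = q_mean 1 f"
  obtain A :: "real^'n^'n" where A: "A ** S ** transpose A = mat 1"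
    and detS: "det S = 1 / (det A)\<^sup>2" and dA: "det A \<noteq> 0"
    using exists_whitening_covariance[OF f cov] by (auto simp: S_def)
  have dS: "sqrt (det S) = 1 / \<bar>det A\<bar>"
    by (simp add: detS real_sqrt_divide)
  have nrm: "f x * (norm (A *v (x - m)))\<^sup>2 = (\<Sum>i\<in>UNIV. f x * ((A $ i \<bullet> (x - m)) * (A $ i \<bullet> (x - m))))" for x
    unfolding power2_norm_eq_inner inner_vec_def[of "A *v _"] matrix_vector_mul_component
    by (simp add: sum_distrib_left)
  note form = covariance_form[OF f cov, folded m_def S_def]
  have diag: "A $ i \<bullet> (S *v A $ i) = 1" for i
    using arg_cong[OF A, of "\<lambda>M. M $ i $ i"]
    by (simp add: matrix_conjugate_nth mat_def)
  let ?C = "(2 * pi * exp 1) powr (real CARD('n) / 2)"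
  have "(\<bar>det A\<bar> / ?C) powr (q - 1) \<le> (LINT x|lebesgue. f x powr q)"
  proof (rule gaussian_power_bound[OF f q int_fq dA])
    show "integrable lebesgue (\<lambda>x. f x * (norm (A *v (x - m)))\<^sup>2)"
      unfolding nrm by (intro Bochner_Integration.integrable_sum form)
    show "(LINT x|lebesgue. f x * (norm (A *v (x - m)))\<^sup>2) = real CARD('n)"
      unfolding nrm Bochner_Integration.integral_sum[OF form(1)] form(2)[symmetric] diag by simp
  qed
  \<comment> \<open>The exponent \<open>1 / (1 - q)\<close> is negative, so the inequality is
    reversed.\<close>
  then have "(LINT x|lebesgue. f x powr q) powr (1 / (1 - q)) \<le> ((\<bar>det A\<bar> / ?C) powr (q - 1)) powr (1 / (1 - q))"
    using q dA by (intro powr_mono2') auto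
  also have "\<dots> = (\<bar>det A\<bar> / ?C) powr (- 1)"
  proof -
    have "(q - 1) * (1 / (1 - q)) = - 1"
      using q by (simp add: field_simps)
    then show ?thesis
      unfolding powr_powr by (rule arg_cong)
  qed
  also have "\<dots> = ?C * sqrt (det S)"
    using dA by (simp add: dS powr_minus_divide)
  finally show ?thesis
    by (simp add: S_def)
qed

section \<open>From power integrals to the Tsallis entropy\<close>

lemma ennpowr_ennpowr_inverse:
  assumes "q > 0"
  shows "ennpowr (ennpowr x (1 / q)) q = x"
  using assms by (cases x) (auto simp: ennpowr_def powr_powr)

lemma q_exp_tsallis_entropy_finite:
  fixes f :: "real^'n \<Rightarrow> real"
  assumes "q > 0" "q \<noteq> 1" "\<And>x. 0 \<le> f x" "integrable lebesgue (\<lambda>x. f x powr q)"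
  shows "q_exp q (tsallis_entropy q f) = ereal ((LINT x|lebesgue. f x powr q) powr (1 / (1 - q)))"
proof -
  define J where "J = (LINT x|lebesgue. f x powr q)"
  have "(\<integral>\<^sup>+x. ennreal (\<bar>f x\<bar> powr q) \<partial>lebesgue) = ennreal J"
    using assms nn_integral_eq_integral[OF assms(4)] by (simp add: J_def)
  moreover have "J \<ge> 0"
    by (simp add: J_def)
  ultimately have "tsallis_entropy q f = ereal (1 / (q - 1) * (1 - J))"
    using assms(1) by (simp add: tsallis_entropy_def Lq_norm_def ennpowr_ennpowr_inverse one_ereal_def)
  moreover have "1 + (1 - q) * (1 / (q - 1) * (1 - J)) = J"
    using assms(2) by (simp add: field_simps)
  ultimately show ?thesis
    by (simp add: q_exp_def J_def)
qed

text \<open>The positive factor \<open>1 / (q - 1)\<close> keeps the entropy at minus infinity,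
  where \<open>q_exp\<close> is set to 0.\<close>

lemma q_exp_tsallis_entropy_infinite:
  fixes f :: "real^'n \<Rightarrow> real"
  assumes "q > 1" "(\<integral>\<^sup>+x. ennreal (\<bar>f x\<bar> powr q) \<partial>lebesgue) = \<infinity>"
  shows "q_exp q (tsallis_entropy q f) = 0"
proof -
  have "(1 :: ereal) - \<infinity> = - \<infinity>"
    by (subst one_ereal_def) (rule ereal_minus)
  then have "tsallis_entropy q f = - \<infinity>"
    using assms by (simp add: tsallis_entropy_def Lq_norm_def ennpowr_ennpowr_inverse)
  then show ?thesis by (simp add: q_exp_def)
qed

lemma q_exp_le_covariance:
  fixes f :: "real^'n \<Rightarrow> real"
  assumes f: "prob_density f" and cov: "finite_q_covariance 1 f" and q: "q > 1"
  shows "q_exp q (tsallis_entropy q f)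
    \<le> ereal ((2 * pi * exp 1) powr (real CARD('n) / 2) * sqrt (det (q_covariance 1 f)))"
proof -
  have f0: "f x \<ge> 0" and [measurable]: "f \<in> borel_measurable lebesgue" for x
    using f by (auto simp: prob_density_def)
  show ?thesis
  proof (cases "(\<integral>\<^sup>+x. ennreal (\<bar>f x\<bar> powr q) \<partial>lebesgue) = \<infinity>")
    case True
    \<comment> \<open>The left side of the goal is 0, and \<open>sqrt\<close> of a negative number
      would be negative, so the sign of the determinant matters.\<close>
    have "0 \<le> det (q_covariance 1 f)"
      using det_covariance_pos[OF f cov] by simp
    with True q show ?thesis
      by (simp add: q_exp_tsallis_entropy_infinite)
  next
    case False
    then have "integrable lebesgue (\<lambda>x. f x powr q)"
      using f0 by (intro integrableI_nonneg) (auto simp: top.not_eq_extremum)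
    then show ?thesis
      using q f0 covariance_power_bound[OF f cov q] by (simp add: q_exp_tsallis_entropy_finite)
  qed
qed

lemma q_exp_le_q_covariance:
  fixes f :: "real^'n \<Rightarrow> real"
  assumes f: "prob_density f" and q: "0 < q" "q < 1"
    and fin: "Lq_norm q f < \<infinity>" and cov: "finite_q_covariance q f"
  shows "q_exp q (tsallis_entropy q f)
    \<le> ereal ((2 * pi * exp 1) powr (real CARD('n) / 2) * sqrt (det (q_covariance q f)))"
proof -
  have f0: "f x \<ge> 0" and [measurable]: "f \<in> borel_measurable lebesgue" for x
    using f by (auto simp: prob_density_def)
  have "(\<integral>\<^sup>+x. ennreal (f x powr q) \<partial>lebesgue) < \<infinity>"
    using fin f0 by (auto simp: Lq_norm_def ennpowr_def top.not_eq_extremum split: if_splits)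
  then have int: "integrable lebesgue (\<lambda>x. f x powr q)"
    by (intro integrableI_nonneg) auto
  define N where "N = (LINT x|lebesgue. f x powr q)"
  have "N \<noteq> 0"
  proof
    assume "N = 0"
    then have "AE x in lebesgue. f x powr q = 0"
      using integral_nonneg_eq_0_iff_AE[OF int] by (simp add: N_def)
    then have "(\<integral>\<^sup>+ x. ennreal (f x) \<partial>lebesgue) = 0"
      by (subst nn_integral_cong_AE[of _ "\<lambda>_. 0"]) auto
    then show False
      using f by (simp add: prob_density_def)
  qed
  moreover have "N \<ge> 0"
    by (simp add: N_def)
  ultimately have N: "N > 0" by simp
  \<comment> \<open>The escort density; dividing by \<open>N\<close> is legitimate because
    \<open>N = 0\<close> would make \<open>f\<close> vanish almost everywhere.\<close>
  define h where "h x = f x powr q / N" for x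
  have h0: "h x \<ge> 0" for x
    using N by (simp add: h_def)
  have "integrable lebesgue h" "(LINT x|lebesgue. h x) = 1"
    unfolding h_def using int N by (simp_all flip: N_def)
  then have "(\<integral>\<^sup>+x. ennreal (h x) \<partial>lebesgue) = 1"
    using nn_integral_eq_integral[of lebesgue h] h0 by simp
  then have h: "prob_density h"
    using h0 by (auto simp: prob_density_def h_def[abs_def])
  have h_cov: "finite_q_covariance 1 h"
  proof -
    have "(\<integral>\<^sup>+x. ennreal ((norm x)\<^sup>2 * \<bar>h x\<bar> powr 1) \<partial>lebesgue) =
        (\<integral>\<^sup>+x. ennreal (1 / N) * ennreal ((norm x)\<^sup>2 * \<bar>f x\<bar> powr q) \<partial>lebesgue)"
      using h0 N f0 by (intro nn_integral_cong) (simp add: h_def flip: ennreal_mult)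
    also have "\<dots> = ennreal (1 / N) * (\<integral>\<^sup>+x. ennreal ((norm x)\<^sup>2 * \<bar>f x\<bar> powr q) \<partial>lebesgue)"
    proof (rule nn_integral_cmult)
      have [measurable]: "(\<lambda>x. (norm x)\<^sup>2) \<in> borel_measurable (lebesgue :: (real^'n) measure)"
        by (intro lborel_to_lebesgue_measurable) measurable
      show "(\<lambda>x. ennreal ((norm x)\<^sup>2 * \<bar>f x\<bar> powr q)) \<in> borel_measurable lebesgue"
        by measurable
    qed
    also have "\<dots> < \<infinity>"
      using cov by (simp add: finite_q_covariance_def ennreal_mult_less_top)
    finally show ?thesis
      by (simp add: finite_q_covariance_def)
  qed
  \<comment> \<open>The value type is left general: the identity is applied to the vector-valued
    mean and to the matrix-valued covariance.\<close>
  have expect: "q_expectation 1 h G = q_expectation q f G" for G :: "real^'n \<Rightarrow> 'b::euclidean_space"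
  proof -
    have "(\<bar>h x\<bar> powr 1) *\<^sub>R G x = inverse N *\<^sub>R ((\<bar>f x\<bar> powr q) *\<^sub>R G x)" for x
      using h0 N f0 by (simp add: h_def divide_inverse mult.commute)
    moreover have "(LINT x|lebesgue. \<bar>h x\<bar> powr 1) = 1"
      using h0 prob_density_integral(2)[OF h] by simp
    moreover have "(LINT x|lebesgue. \<bar>f x\<bar> powr q) = N"
      using f0 by (simp add: N_def)
    ultimately show ?thesis
      unfolding q_expectation_def by (simp only: integral_scaleR_right inverse_1 scaleR_one)
  qed
  have same_cov: "q_covariance 1 h = q_covariance q f"
    by (simp add: q_covariance_def q_mean_def expect)
  have h_powr: "h x powr (1 / q) = f x * N powr (- (1 / q))" for x
  proof -
    have "h x powr (1 / q) = (f x powr q) powr (1 / q) / N powr (1 / q)"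
      unfolding h_def by (rule powr_divide)
    then show ?thesis
      using f0 q by (simp add: powr_powr powr_minus divide_inverse)
  qed
  have "(LINT x|lebesgue. h x powr (1 / q)) = N powr (- (1 / q))"
    unfolding h_powr using prob_density_integral[OF f] by simp
  moreover have "integrable lebesgue (\<lambda>x. h x powr (1 / q))"
    unfolding h_powr using prob_density_integral[OF f] by simp
  \<comment> \<open>The bound of order \<open>1 / q\<close> raises \<open>N powr (- (1 / q))\<close>
    to the power \<open>1 / (1 - 1 / q)\<close>; the result is the exponential of the entropy of
    order \<open>q\<close>.\<close>
  moreover have "- (1 / q) * (1 / (1 - 1 / q)) = 1 / (1 - q)"
    using q by (simp add: field_simps)
  ultimately have "N powr (1 / (1 - q)) \<le> (2 * pi * exp 1) powr (real CARD('n) / 2) * sqrt (det (q_covariance q f))"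
    using covariance_power_bound[OF h h_cov, of "1 / q"] q by (simp add: same_cov powr_powr)
  then show ?thesis
    using q f0 int by (simp add: q_exp_tsallis_entropy_finite N_def)
qed

theorem corollary3:
  fixes f :: "real ^ 'n \<Rightarrow> real"
  assumes "prob_density f"
  shows "(\<forall>q>1. finite_q_covariance 1 f \<longrightarrow>
            q_exp q (tsallis_entropy q f)
              \<le> ereal ((2 * pi * exp 1) powr (real CARD('n) / 2) * sqrt (det (q_covariance 1 f))))
       \<and> (\<forall>q. 0 < q \<and> q < 1 \<and> Lq_norm q f < \<infinity> \<and> finite_q_covariance q f \<longrightarrow>
            q_exp q (tsallis_entropy q f)
              \<le> ereal ((2 * pi * exp 1) powr (real CARD('n) / 2) * sqrt (det (q_covariance q f))))"
  using assms q_exp_le_covariance q_exp_le_q_covariance by blast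

end
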